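(* Let $\Pi\colon A^3\to A$ be a pivotal operation such that $\Lambda_\Pi$ is a clone on $A$ that contains $\Pi$. Then $\Lambda_\Pi$ is the clone generated by $\Pi$ and the constant maps. In particular, $\Lambda_\Pi=N_\Pi$ (as sets of operations of positive arity).
   Context: $A$ is an arbitrary fixed nonempty set, and $0$ and $1$ are two fixed elements of $A$. An ($n$-ary) operation on $A$ is a map $f\colon A^n\to A$, $n\ge 1$; nullary operations are identified with elements of $A$. For $\mathbf{x}\in A^n$, $i\in\{1,\dots,n\}$ and $c\in A$, $\mathbf{x}_i^c$ denotes the tuple obtained from $\mathbf{x}$ by replacing its $i$-th component by $c$. A pivotal operation on $A$ is a ternary operation $\Pi$ on $A$ with $\Pi(x,y,y)=y$ for all $x,y\in A$. An operation $f\colon A^n\to A$ is $\Pi$-decomposable if $f(\mathbf{x})=\Pi(x_i,f(\mathbf{x}_i^1),f(\mathbf{x}_i^0))$ for all $\mathbf{x}\in A^n$ and all $i\in\{1,\dots,n\}$. $\Lambda_\Pi$ is the class of all $\Pi$-decomposable operations on $A$. The $k$-ary $\Pi$-normal forms are defined inductively: $N_\Pi^0$ is the set of nullary operations on $A$, and for $k\ge 0$, $N_\Pi^{k+1}$ is the set of $(k+1)$-ary operations of the form $(x_1,\dots,x_{k+1})\mapsto \Pi(x_{k+1},g(x_1,\dots,x_k),g'(x_1,\dots,x_k))$ with $g,g'\in N_\Pi^k$; $N_\Pi=\bigcup_{k\ge 0}N_\Pi^k$. A clone on $A$ is a set of operations on $A$ that contains all projections $p_i^n(x_1,\dots,x_n)=x_i$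 and is closed under composition: if $f$ ($n$-ary) and $g_1,\dots,g_n$ ($m$-ary) belong to it, so does $\mathbf{x}\mapsto f(g_1(\mathbf{x}),\dots,g_n(\mathbf{x}))$. The clone generated by a set of operations is the smallest clone containing it. *)

theory Defs
  imports HOL.Hull "HOL-Library.FuncSet"
begin

text \<open>
  The nonempty set $A$ is rendered as a type \<open>'a\<close>, its $n$-tuples as the lists of length $n$, with
  components indexed from \<open>0\<close>. An $n$-ary operation is a pair of its arity \<open>n\<close> and a function that
  is \<^const>\<open>undefined\<close> outside the lists of length \<open>n\<close>, so that equality of pairs is
  equality of operations and an operation determines its arity.
\<close>

type_synonym 'a operation = "nat \<times> ('a list \<Rightarrow> 'a)"

definition tuples :: "nat \<Rightarrow> 'a list set"
  where "tuples n = {x. length x = n}"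

definition operations :: "nat \<Rightarrow> 'a operation set"
  where "operations n = {n} \<times> (tuples n \<rightarrow>\<^sub>E UNIV)"

definition mk_operation :: "nat \<Rightarrow> ('a list \<Rightarrow> 'a) \<Rightarrow> 'a operation"
  where "mk_operation n f = (n, restrict f (tuples n))"

definition positive_operations :: "'a operation set"
  where "positive_operations = (\<Union>n\<in>{1..}. operations n)"

definition projection :: "nat \<Rightarrow> nat \<Rightarrow> 'a operation"
  where "projection n i = mk_operation n (\<lambda>x. x ! i)"

definition composition :: "('a list \<Rightarrow> 'a) \<Rightarrow> nat \<Rightarrow> ('a list \<Rightarrow> 'a) list \<Rightarrow> 'a operation"
  where "composition f m gs = mk_operation m (\<lambda>x. f (map (\<lambda>g. g x) gs))"

text \<open>The clone generated by a set \<open>S\<close> of operations is \<open>clone hull S\<close>.\<close>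

definition clone :: "'a operation set \<Rightarrow> bool"
  where "clone C \<longleftrightarrow>
    C \<subseteq> positive_operations \<and>
    (\<forall>n. \<forall>i<n. projection n i \<in> C) \<and>
    (\<forall>n m f gs. (n, f) \<in> C \<and> length gs = n \<and> (\<forall>g\<in>set gs. (m, g) \<in> C) \<longrightarrow>
       composition f m gs \<in> C)"

definition constant_maps :: "'a operation set"
  where "constant_maps = {mk_operation n (\<lambda>_. c) | n c. n \<ge> 1}"

definition ternary :: "('a \<Rightarrow> 'a \<Rightarrow> 'a \<Rightarrow> 'a) \<Rightarrow> 'a operation"
  where "ternary P = mk_operation 3 (\<lambda>x. P (x ! 0) (x ! 1) (x ! 2))"

definition pivotal :: "('a \<Rightarrow> 'a \<Rightarrow> 'a \<Rightarrow> 'a) \<Rightarrow> bool"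
  where "pivotal P \<longleftrightarrow> (\<forall>x y. P x y y = y)"

text \<open>
  The fixed elements $0$ and $1$ of $A$ are the parameters \<open>zero\<close> and \<open>one\<close>. They are not required
  to be distinct, as $A$ may be a singleton.
\<close>

definition decomposable ::
    "'a \<Rightarrow> 'a \<Rightarrow> ('a \<Rightarrow> 'a \<Rightarrow> 'a \<Rightarrow> 'a) \<Rightarrow> nat \<Rightarrow> ('a list \<Rightarrow> 'a) \<Rightarrow> bool"
  where "decomposable zero one P n f \<longleftrightarrow>
    (\<forall>x\<in>tuples n. \<forall>i<n. f x = P (x ! i) (f (x[i := one])) (f (x[i := zero])))"

definition Lambda_class :: "'a \<Rightarrow> 'a \<Rightarrow> ('a \<Rightarrow> 'a \<Rightarrow> 'a \<Rightarrow> 'a) \<Rightarrow> 'a operation set"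
  where "Lambda_class zero one P =
    {(n, f). (n, f) \<in> positive_operations \<and> decomposable zero one P n f}"

primrec normal_forms_arity :: "('a \<Rightarrow> 'a \<Rightarrow> 'a \<Rightarrow> 'a) \<Rightarrow> nat \<Rightarrow> 'a operation set"
  where
    "normal_forms_arity P 0 = operations 0"
  | "normal_forms_arity P (Suc k) =
      {mk_operation (Suc k) (\<lambda>x. P (last x) (g (butlast x)) (g' (butlast x))) | g g'.
        (k, g) \<in> normal_forms_arity P k \<and> (k, g') \<in> normal_forms_arity P k}"

definition normal_forms :: "('a \<Rightarrow> 'a \<Rightarrow> 'a \<Rightarrow> 'a) \<Rightarrow> 'a operation set"
  where "normal_forms P = (\<Union>k. normal_forms_arity P k)"

end

theory Submission imports Defs begin

text \<open>
  The three classes are linked by a circle of inclusions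
  \<open>\<Lambda> \<subseteq> N \<subseteq> clone generated by P and the constants \<subseteq> \<Lambda>\<close>,
  with \<open>N\<close> taken in positive arity.

  Decomposing \<open>f\<close> at its last variable expresses it by \<open>P\<close>, that variable and the two sections of
  \<open>f\<close> at \<open>one\<close> and \<open>zero\<close>. These sections are decomposable again, of arity one less, so that
  iterating down to arity \<open>0\<close>, where only an element of the carrier remains, produces a normal form
  (\<open>decomposable_imp_normal_form\<close>). A normal form is a term in \<open>P\<close>, the variables and
  elements of the carrier, and so it lies in every clone that contains \<open>P\<close> and the constant maps
  (\<open>padded_normal_form_in_clone\<close>). Finally, a constant map is decomposable exactly because
  \<open>P x c c = c\<close>; hence \<open>\<Lambda>\<close>, once it is a clone and contains \<open>P\<close>, is among the clones
  over which the generated clone is the intersection.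
\<close>

lemma constant_maps_decomposable:
  assumes "pivotal P"
  shows "constant_maps \<subseteq> Lambda_class zero one P"
  using assms
  by (auto simp: constant_maps_def Lambda_class_def positive_operations_def operations_def
      decomposable_def pivotal_def mk_operation_def tuples_def split: if_splits)

text \<open>
  The induction has to start at arity \<open>0\<close>, below the arities of \<open>\<Lambda>\<close>: decomposability is vacuous
  there, and a nullary operation is a normal form by definition.
\<close>

lemma decomposable_imp_normal_form:
  assumes "f \<in> tuples n \<rightarrow>\<^sub>E UNIV" and "decomposable zero one P n f"
  shows "(n, f) \<in> normal_forms_arity P n"
  using assms
proof (induction n arbitrary: f)
  case 0
  then show ?case by (simp add: operations_def)
next
  case (Suc k)
  define g where "g = (\<lambda>c. restrict (\<lambda>y. f (y @ [c])) (tuples k))"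
  have dec: "f x = P (x ! i) (f (x[i := one])) (f (x[i := zero]))"
    if "length x = Suc k" "i < Suc k" for x i
    using Suc.prems(2) that unfolding decomposable_def tuples_def by blast
  have sections: "(k, g c) \<in> normal_forms_arity P k" for c
  proof (rule Suc.IH)
    show "g c \<in> tuples k \<rightarrow>\<^sub>E UNIV" by (simp add: g_def)
    show "decomposable zero one P k (g c)"
      unfolding decomposable_def
    proof (intro ballI allI impI)
      fix y :: "'a list" and i
      assume y: "y \<in> tuples k" and i: "i < k"
      then show "g c y = P (y ! i) (g c (y[i := one])) (g c (y[i := zero]))"
        using dec[of "y @ [c]" i]
        by (simp add: g_def tuples_def nth_append list_update_append)
    qed
  qed
  have "f x = P (last x) (g one (butlast x)) (g zero (butlast x))" if "x \<in> tuples (Suc k)" for x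
  proof -
    from that obtain y a where x: "x = y @ [a]" and y: "length y = k"
      by (auto simp: tuples_def length_Suc_conv_rev)
    show ?thesis
      using dec[of x k] by (simp add: x g_def tuples_def flip: y)
  qed
  then have "(Suc k, f) =
      mk_operation (Suc k) (\<lambda>x. P (last x) (g one (butlast x)) (g zero (butlast x)))"
    unfolding mk_operation_def prod.inject
    by (intro conjI refl PiE_ext[OF Suc.prems(1) restrict_PiE_iff[THEN iffD2]]) simp_all
  then show ?case
    using sections by auto
qed

lemma clone_closed_under_ternary:
  assumes "clone C" and "ternary P \<in> C"
    and "mk_operation m f \<in> C" "mk_operation m g \<in> C" "mk_operation m h \<in> C"
  shows "mk_operation m (\<lambda>x. P (f x) (g x) (h x)) \<in> C"
proof -
  define t where "t = restrict (\<lambda>x. P (x ! 0) (x ! 1) (x ! 2)) (tuples 3)"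
  define gs where "gs = map (\<lambda>f. restrict f (tuples m)) [f, g, h]"
  have "(3, t) \<in> C" "length gs = 3" "\<forall>g\<in>set gs. (m, g) \<in> C"
    using assms(2-5) by (simp_all add: t_def gs_def ternary_def mk_operation_def)
  then have "composition t m gs \<in> C"
    using assms(1) unfolding clone_def by blast
  moreover have "composition t m gs = mk_operation m (\<lambda>x. P (f x) (g x) (h x))"
    by (auto simp: composition_def mk_operation_def t_def gs_def tuples_def fun_eq_iff)
  ultimately show ?thesis by simp
qed

text \<open>
  Composition requires the inner operations to share one arity, whereas the arities of the nested
  normal forms decrease. Therefore all of them are read as operations of a common positive
  arity \<open>m\<close> that depend on their first \<open>k\<close> variables only; at \<open>k = 0\<close> this turns the
  elements of the carrier into constant maps.
\<close>

lemma padded_normal_form_in_clone: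
  assumes "clone C" and "ternary P \<in> C" and "constant_maps \<subseteq> C"
    and "(k, f) \<in> normal_forms_arity P k" and "k \<le> m" and "1 \<le> m"
  shows "mk_operation m (\<lambda>x. f (take k x)) \<in> C"
  using assms(4,5)
proof (induction k arbitrary: f)
  case 0
  then show ?case
    using assms(3,6) by (auto simp: constant_maps_def)
next
  case (Suc k)
  then obtain g g' where
    gg': "(k, g) \<in> normal_forms_arity P k" "(k, g') \<in> normal_forms_arity P k" and
    f: "(Suc k, f) = mk_operation (Suc k) (\<lambda>x. P (last x) (g (butlast x)) (g' (butlast x)))"
    by auto
  have "k \<le> m"
    using Suc.prems(2) by simp
  have "mk_operation m (\<lambda>x. x ! k) \<in> C"
    using assms(1) Suc.prems(2) unfolding clone_def projection_def by (meson Suc_le_eq)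
  then have "mk_operation m (\<lambda>x. P (x ! k) (g (take k x)) (g' (take k x))) \<in> C"
    using Suc.IH[OF gg'(1) \<open>k \<le> m\<close>] Suc.IH[OF gg'(2) \<open>k \<le> m\<close>]
    by (rule clone_closed_under_ternary[OF assms(1,2)])
  moreover have "f (take (Suc k) x) = P (x ! k) (g (take k x)) (g' (take k x))"
    if "x \<in> tuples m" for x
  proof -
    have "length x = m"
      using that by (simp add: tuples_def)
    moreover have "f = restrict (\<lambda>x. P (last x) (g (butlast x)) (g' (butlast x))) (tuples (Suc k))"
      using f by (simp add: mk_operation_def)
    ultimately show ?thesis
      using Suc.prems(2) by (simp add: tuples_def take_Suc_conv_app_nth)
  qed
  then have "mk_operation m (\<lambda>x. f (take (Suc k) x)) =
      mk_operation m (\<lambda>x. P (x ! k) (g (take k x)) (g' (take k x)))"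
    unfolding mk_operation_def prod.inject by (intro conjI refl restrict_ext)
  ultimately show ?case by simp
qed

lemma normal_forms_arity_subset_operations: "normal_forms_arity P k \<subseteq> operations k"
  by (cases k) (auto simp: operations_def mk_operation_def)

lemma normal_forms_subset_clone:
  assumes "clone C" and "ternary P \<in> C" and "constant_maps \<subseteq> C"
  shows "normal_forms P \<inter> positive_operations \<subseteq> C"
proof
  fix p
  assume p: "p \<in> normal_forms P \<inter> positive_operations"
  then obtain k where k: "p \<in> normal_forms_arity P k"
    by (auto simp: normal_forms_def)
  then have "p \<in> operations k"
    using normal_forms_arity_subset_operations by blast
  then obtain f where f: "p = (k, f)" "f \<in> tuples k \<rightarrow>\<^sub>E UNIV"
    by (auto simp: operations_def)
  have "1 \<le> k"
    using p f(1) by (auto simp: positive_operations_def operations_def)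
  then have "mk_operation k (\<lambda>x. f (take k x)) \<in> C"
    using padded_normal_form_in_clone[OF assms, of k f k] k f(1) by simp
  moreover have "mk_operation k (\<lambda>x. f (take k x)) = p"
    using f by (auto simp: mk_operation_def tuples_def fun_eq_iff PiE_def extensional_def)
  ultimately show "p \<in> C" by simp
qed

theorem proposition3p6:
  fixes P :: "'a \<Rightarrow> 'a \<Rightarrow> 'a \<Rightarrow> 'a" and zero one :: 'a
  assumes "pivotal P"
    and "clone (Lambda_class zero one P)"
    and "ternary P \<in> Lambda_class zero one P"
  shows "Lambda_class zero one P = clone hull (insert (ternary P) constant_maps) \<and>
    Lambda_class zero one P = normal_forms P \<inter> positive_operations"
proof -
  let ?L = "Lambda_class zero one P"
  let ?H = "clone hull (insert (ternary P) constant_maps)"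
  let ?N = "normal_forms P \<inter> positive_operations"
  have "?L \<subseteq> ?N"
  proof
    fix p
    assume p: "p \<in> ?L"
    then obtain n f where
      f: "p = (n, f)" "f \<in> tuples n \<rightarrow>\<^sub>E UNIV" "decomposable zero one P n f"
      by (auto simp: Lambda_class_def positive_operations_def operations_def)
    have "(n, f) \<in> normal_forms_arity P n"
      by (rule decomposable_imp_normal_form[OF f(2,3)])
    then have "p \<in> normal_forms P"
      unfolding normal_forms_def f(1) by (rule UN_I[OF UNIV_I])
    moreover have "p \<in> positive_operations"
      using p unfolding Lambda_class_def by blast
    ultimately show "p \<in> ?N" ..
  qed
  moreover have "?N \<subseteq> ?H"
    unfolding hull_def by (rule Inter_greatest, rule normal_forms_subset_clone) simp_all
  moreover have "?H \<subseteq> ?L"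
    using assms constant_maps_decomposable[OF assms(1)] by (simp add: hull_minimal)
  ultimately show ?thesis
    by (meson subset_antisym subset_trans)
qed

end
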